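(* For every finite simple graph $G$ and every ambient dimension $d\geq 1$, the irreducible components of $\mathcal{X}^d(G)$ are exactly the maximal (with respect to inclusion) sets of the form $\overline{\mathcal{X}^d_\pi(G)}$, where $\pi$ ranges over the set partitions of $V(G)$.
   Context: Let $\mathbb{F}$ be an algebraically closed field and $\mathbb{P}^d$ the projective $d$-space over $\mathbb{F}$. Let $G$ be a finite simple graph with vertex set $V$ and edge set $E$. A picture $P$ of $G$ in $\mathbb{P}^d$ consists of a point $P(v)\in\mathbb{P}^d$ for each vertex $v$ and a line $P(e)\subseteq\mathbb{P}^d$ for each edge $e$, such that $P(v)\in P(e)$ whenever $v$ is an endpoint of $e$. The picture space $\mathcal{X}^d(G)$ is the set of all pictures of $G$, regarded as a Zariski-closed (reduced) algebraic subset of the product of $|V|$ copies of $\mathbb{P}^d$ and $|E|$ copies of the Grassmannian of lines in $\mathbb{P}^d$. For a set partition $\pi$ of $V$, write $v\sim_\pi w$ if $v,w$ lie in the same block of $\pi$. The cellule of $\pi$ is $\mathcal{X}^d_\pi(G)=\{P\in\mathcal{X}^d(G) : P(v)=P(w)\iff v\sim_\pi w\}$. The bar denotes Zariski closure in $\mathcal{X}^d(G)$. *)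

theory Defs
  imports
    "HOL-Analysis.Analysis"
    "HOL-Library.Poly_Mapping"
    "HOL-Library.Disjoint_Sets"
    "HOL-Computational_Algebra.Polynomial"
begin

section \<open>Graphs and pictures\<close>

definition finite_simple_graph :: "'v set \<Rightarrow> 'v set set \<Rightarrow> bool" where
  "finite_simple_graph V E \<longleftrightarrow> finite V \<and> (\<forall>e\<in>E. e \<subseteq> V \<and> card e = 2)"

text \<open>
  Projective \<open>d\<close>-space over \<open>'a\<close> is the projectivization of \<open>'a ^ 'n\<close> with \<open>CARD('n) = d + 1\<close>:
  its points are the one-dimensional and its lines the two-dimensional linear subspaces, and
  a point lies on a line iff the former subspace is contained in the latter.
\<close>

definition proj_points :: "('a::field ^ 'n::finite) set set" where
  "proj_points = {p. vec.subspace p \<and> vec.dim p = 1}"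

definition proj_lines :: "('a::field ^ 'n::finite) set set" where
  "proj_lines = {l. vec.subspace l \<and> vec.dim l = 2}"

type_synonym ('v, 'a, 'n) picture = "('v \<Rightarrow> ('a ^ 'n) set) \<times> ('v set \<Rightarrow> ('a ^ 'n) set)"

text \<open>
  The product of one copy of projective space per vertex and one copy of the Grassmannian of
  lines per edge.
\<close>

definition ambient :: "'v set \<Rightarrow> 'v set set \<Rightarrow> ('v, 'a::field, 'n::finite) picture set" where
  "ambient V E = (V \<rightarrow>\<^sub>E proj_points) \<times> (E \<rightarrow>\<^sub>E proj_lines)"

definition picture_space :: "'v set \<Rightarrow> 'v set set \<Rightarrow> ('v, 'a::field, 'n::finite) picture set" where
  "picture_space V E = {P \<in> ambient V E. \<forall>e\<in>E. \<forall>v\<in>e. fst P v \<subseteq> snd P e}"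

definition same_block :: "'v set set \<Rightarrow> 'v \<Rightarrow> 'v \<Rightarrow> bool" where
  "same_block \<pi> v w \<longleftrightarrow> (\<exists>B\<in>\<pi>. v \<in> B \<and> w \<in> B)"

definition cellule :: "'v set \<Rightarrow> 'v set set \<Rightarrow> 'v set set \<Rightarrow> ('v, 'a::field, 'n::finite) picture set" where
  "cellule V E \<pi> =
     {P \<in> picture_space V E. \<forall>v\<in>V. \<forall>w\<in>V. fst P v = fst P w \<longleftrightarrow> same_block \<pi> v w}"


section \<open>The Zariski topology\<close>

type_synonym ('x, 'a) mpoly = "('x \<Rightarrow>\<^sub>0 nat) \<Rightarrow>\<^sub>0 'a"

definition eval_mpoly :: "('x \<Rightarrow> 'a) \<Rightarrow> ('x, 'a::comm_ring_1) mpoly \<Rightarrow> 'a" where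
  "eval_mpoly x f =
     (\<Sum>m\<in>Poly_Mapping.keys f. Poly_Mapping.lookup f m *
        (\<Prod>k\<in>Poly_Mapping.keys m. x k ^ Poly_Mapping.lookup m k))"

text \<open>
  Homogeneous coordinates on the ambient product: the usual ones for each point and the
  Pluecker coordinates for each line. All index pairs \<open>(i, j)\<close> are used for the latter, not only
  those with \<open>i < j\<close>; the additional coordinates are zero or negatives of the others, so the
  zero loci are the same.
\<close>

datatype ('v, 'n) coord = PointCoord 'v 'n | LineCoord "'v set" 'n 'n

definition coords :: "'v set \<Rightarrow> 'v set set \<Rightarrow> ('v, 'n) coord set" where
  "coords V E = {PointCoord v i |v i. v \<in> V} \<union> {LineCoord e i j |e i j. e \<in> E}"

definition pluecker :: "'a::field ^ 'n::finite \<Rightarrow> 'a ^ 'n \<Rightarrow> 'n \<Rightarrow> 'n \<Rightarrow> 'a" where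
  "pluecker u w i j = u $ i * w $ j - u $ j * w $ i"

definition homogeneous_coords ::
    "'v set \<Rightarrow> 'v set set \<Rightarrow> ('v, 'a::field, 'n::finite) picture \<Rightarrow> (('v, 'n) coord \<Rightarrow> 'a) set" where
  "homogeneous_coords V E P = {x.
     (\<forall>v\<in>V. fst P v = vec.span {\<chi> i. x (PointCoord v i)}) \<and>
     (\<forall>e\<in>E. \<exists>u w. snd P e = vec.span {u, w} \<and>
                   (\<forall>i j. x (LineCoord e i j) = pluecker u w i j))}"

definition multihomogeneous ::
    "'v set \<Rightarrow> 'v set set \<Rightarrow> (('v, 'n::finite) coord, 'a::field) mpoly \<Rightarrow> bool" where
  "multihomogeneous V E f \<longleftrightarrow> (\<exists>a b. \<forall>m\<in>Poly_Mapping.keys f.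
     Poly_Mapping.keys m \<subseteq> coords V E \<and>
     (\<forall>v\<in>V. (\<Sum>i\<in>UNIV. Poly_Mapping.lookup m (PointCoord v i)) = a v) \<and>
     (\<forall>e\<in>E. (\<Sum>i\<in>UNIV. \<Sum>j\<in>UNIV. Poly_Mapping.lookup m (LineCoord e i j)) = b e))"

text \<open>
  For multihomogeneous polynomials vanishing does not depend on the choice of homogeneous
  coordinates (lemma \<open>multihomogeneous_vanish_iff\<close> below).
\<close>

definition zero_locus ::
    "'v set \<Rightarrow> 'v set set \<Rightarrow> (('v, 'n::finite) coord, 'a::field) mpoly set \<Rightarrow> ('v, 'a, 'n) picture set"
  where
  "zero_locus V E F =
     {P \<in> ambient V E. \<forall>f\<in>F. \<forall>x\<in>homogeneous_coords V E P. eval_mpoly x f = 0}"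

definition zariski :: "'v set \<Rightarrow> 'v set set \<Rightarrow> ('v, 'a::field, 'n::finite) picture topology" where
  "zariski V E = topology (\<lambda>U. \<exists>F.
     (\<forall>f\<in>F. multihomogeneous V E f) \<and> U = ambient V E - zero_locus V E F)"

definition picture_topology ::
    "'v set \<Rightarrow> 'v set set \<Rightarrow> ('v, 'a::field, 'n::finite) picture topology" where
  "picture_topology V E = subtopology (zariski V E) (picture_space V E)"


section \<open>Irreducible components\<close>

definition irreducible_in :: "'b topology \<Rightarrow> 'b set \<Rightarrow> bool" where
  "irreducible_in X S \<longleftrightarrow> S \<subseteq> topspace X \<and> S \<noteq> {} \<and>
     (\<forall>C D. closedin X C \<and> closedin X D \<and> S \<subseteq> C \<union> D \<longrightarrow> S \<subseteq> C \<or> S \<subseteq> D)"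

definition irreducible_components :: "'b topology \<Rightarrow> 'b set set" where
  "irreducible_components X =
     {S. irreducible_in X S \<and> (\<forall>T. irreducible_in X T \<and> S \<subseteq> T \<longrightarrow> T = S)}"

definition maximal_sets :: "'b set set \<Rightarrow> 'b set set" where
  "maximal_sets \<A> = {S \<in> \<A>. \<forall>T\<in>\<A>. S \<subseteq> T \<longrightarrow> T = S}"


section \<open>The Zariski topology is well defined\<close>

lemma eval_mpoly_superset:
  assumes "finite A" "Poly_Mapping.keys f \<subseteq> A"
  shows "eval_mpoly x f = (\<Sum>m\<in>A. Poly_Mapping.lookup f m * (\<Prod>k\<in>Poly_Mapping.keys m. x k ^ Poly_Mapping.lookup m k))"
  unfolding eval_mpoly_def
  by (rule sum.mono_neutral_left) (use assms in \<open>auto simp: in_keys_iff\<close>)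

lemma eval_mpoly_0 [simp]: "eval_mpoly x 0 = 0"
  by (simp add: eval_mpoly_def)

lemma eval_mpoly_1 [simp]: "eval_mpoly x 1 = 1"
  by (simp add: eval_mpoly_def)

lemma eval_mpoly_add: "eval_mpoly x (f + g) = eval_mpoly x f + eval_mpoly x g"
  using eval_mpoly_superset[of "Poly_Mapping.keys f \<union> Poly_Mapping.keys g" f x] eval_mpoly_superset[of "Poly_Mapping.keys f \<union> Poly_Mapping.keys g" g x]
    eval_mpoly_superset[of "Poly_Mapping.keys f \<union> Poly_Mapping.keys g" "f + g" x] keys_add[of f g]
  by (simp add: lookup_add distrib_right sum.distrib)

lemma eval_mpoly_sum: "eval_mpoly x (sum h A) = (\<Sum>a\<in>A. eval_mpoly x (h a))"
  by (induction A rule: infinite_finite_induct) (auto simp: eval_mpoly_add)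

lemma eval_mpoly_single:
  "eval_mpoly x (Poly_Mapping.single m c) = c * (\<Prod>k\<in>Poly_Mapping.keys m. x k ^ Poly_Mapping.lookup m k)"
  by (cases "c = 0") (auto simp: eval_mpoly_def)

lemma mpoly_sum_single: "f = (\<Sum>m\<in>Poly_Mapping.keys f. Poly_Mapping.single m (Poly_Mapping.lookup f m))"
  by (rule poly_mapping_eqI)
    (auto simp: lookup_sum lookup_single when_def in_keys_iff sum.delta)

lemma monomial_superset:
  fixes x :: "'x \<Rightarrow> 'a::comm_ring_1"
  assumes "finite A" "Poly_Mapping.keys m \<subseteq> A"
  shows "(\<Prod>k\<in>Poly_Mapping.keys m. x k ^ Poly_Mapping.lookup m k) = (\<Prod>k\<in>A. x k ^ Poly_Mapping.lookup m k)"
  by (rule prod.mono_neutral_left) (use assms in \<open>auto simp: in_keys_iff\<close>)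

lemma monomial_add:
  fixes x :: "'x \<Rightarrow> 'a::comm_ring_1" and m n :: "'x \<Rightarrow>\<^sub>0 nat"
  shows "(\<Prod>k\<in>Poly_Mapping.keys (m + n). x k ^ Poly_Mapping.lookup (m + n) k) =
    (\<Prod>k\<in>Poly_Mapping.keys m. x k ^ Poly_Mapping.lookup m k) * (\<Prod>k\<in>Poly_Mapping.keys n. x k ^ Poly_Mapping.lookup n k)"
  using monomial_superset[of "Poly_Mapping.keys m \<union> Poly_Mapping.keys n" m x] monomial_superset[of "Poly_Mapping.keys m \<union> Poly_Mapping.keys n" n x]
    monomial_superset[of "Poly_Mapping.keys m \<union> Poly_Mapping.keys n" "m + n" x] keys_add[of m n]
  by (simp add: lookup_add power_add prod.distrib)

lemma eval_mpoly_mult: "eval_mpoly x (f * g) = eval_mpoly x f * eval_mpoly x g"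
proof -
  have "eval_mpoly x (f * g) = eval_mpoly x ((\<Sum>m\<in>Poly_Mapping.keys f. Poly_Mapping.single m (Poly_Mapping.lookup f m)) *
      (\<Sum>m\<in>Poly_Mapping.keys g. Poly_Mapping.single m (Poly_Mapping.lookup g m)))"
    by (simp flip: mpoly_sum_single)
  also have "\<dots> = (\<Sum>m\<in>Poly_Mapping.keys f. \<Sum>n\<in>Poly_Mapping.keys g.
      (Poly_Mapping.lookup f m * (\<Prod>k\<in>Poly_Mapping.keys m. x k ^ Poly_Mapping.lookup m k)) * (Poly_Mapping.lookup g n * (\<Prod>k\<in>Poly_Mapping.keys n. x k ^ Poly_Mapping.lookup n k)))"
    by (simp add: sum_product eval_mpoly_sum mult_single eval_mpoly_single monomial_add mult_ac)
  also have "\<dots> = eval_mpoly x f * eval_mpoly x g"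
    by (simp add: eval_mpoly_def sum_product)
  finally show ?thesis .
qed

lemma multihomogeneous_1: "multihomogeneous V E 1"
  unfolding multihomogeneous_def by (intro exI[of _ "\<lambda>_. 0"]) auto

lemma multihomogeneous_mult:
  assumes "multihomogeneous V E f" "multihomogeneous V E g"
  shows "multihomogeneous V E (f * g)"
proof -
  from assms(1) obtain a b where f: "\<forall>m\<in>Poly_Mapping.keys f. Poly_Mapping.keys m \<subseteq> coords V E \<and>
     (\<forall>v\<in>V. (\<Sum>i\<in>UNIV. Poly_Mapping.lookup m (PointCoord v i)) = a v) \<and>
     (\<forall>e\<in>E. (\<Sum>i\<in>UNIV. \<Sum>j\<in>UNIV. Poly_Mapping.lookup m (LineCoord e i j)) = b e)"
    unfolding multihomogeneous_def by blast
  from assms(2) obtain a' b' where g: "\<forall>m\<in>Poly_Mapping.keys g. Poly_Mapping.keys m \<subseteq> coords V E \<and>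
     (\<forall>v\<in>V. (\<Sum>i\<in>UNIV. Poly_Mapping.lookup m (PointCoord v i)) = a' v) \<and>
     (\<forall>e\<in>E. (\<Sum>i\<in>UNIV. \<Sum>j\<in>UNIV. Poly_Mapping.lookup m (LineCoord e i j)) = b' e)"
    unfolding multihomogeneous_def by blast
  show ?thesis
    unfolding multihomogeneous_def
  proof (intro exI[of _ "\<lambda>v. a v + a' v"] exI[of _ "\<lambda>e. b e + b' e"] ballI)
    fix m assume "m \<in> Poly_Mapping.keys (f * g)"
    then obtain k l where m: "m = k + l" and k: "k \<in> Poly_Mapping.keys f" and l: "l \<in> Poly_Mapping.keys g"
      using keys_mult[of f g] by blast
    then show "Poly_Mapping.keys m \<subseteq> coords V E \<and>
     (\<forall>v\<in>V. (\<Sum>i\<in>UNIV. Poly_Mapping.lookup m (PointCoord v i)) = a v + a' v) \<and>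
     (\<forall>e\<in>E. (\<Sum>i\<in>UNIV. \<Sum>j\<in>UNIV. Poly_Mapping.lookup m (LineCoord e i j)) = b e + b' e)"
      using bspec[OF f k] bspec[OF g l] keys_add[of k l]
      by (auto simp: lookup_add sum.distrib)
  qed
qed

lemma finite_coords:
  assumes "finite V" "finite E"
  shows "finite (coords V E :: ('v, 'n::finite) coord set)"
proof -
  have "coords V E = (\<lambda>(v, i). PointCoord v i) ` (V \<times> UNIV) \<union>
      (\<lambda>(e, i, j). LineCoord e i j) ` (E \<times> UNIV \<times> (UNIV :: 'n set))"
    by (auto simp: coords_def image_iff)
  then show ?thesis using assms by simp
qed

lemma prod_coords:
  fixes h :: "('v, 'n::finite) coord \<Rightarrow> 'a::comm_monoid_mult"
  assumes "finite V" "finite E"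
  shows "prod h (coords V E) = (\<Prod>v\<in>V. \<Prod>i\<in>UNIV. h (PointCoord v i)) *
    (\<Prod>e\<in>E. \<Prod>i\<in>UNIV. \<Prod>j\<in>UNIV. h (LineCoord e i j))"
proof -
  let ?P = "(\<lambda>(v, i). PointCoord v i) ` (V \<times> (UNIV :: 'n set))"
  let ?L = "(\<lambda>(e, i, j). LineCoord e i j) ` (E \<times> UNIV \<times> (UNIV :: 'n set))"
  have eq: "coords V E = ?P \<union> ?L"
    by (auto simp: coords_def image_iff)
  have "prod h (coords V E) = prod h ?P * prod h ?L"
    unfolding eq by (rule prod.union_disjoint) (use assms in auto)
  also have "prod h ?P = (\<Prod>v\<in>V. \<Prod>i\<in>UNIV. h (PointCoord v i))"
    by (subst prod.reindex) (auto simp: inj_on_def prod.cartesian_product case_prod_unfold)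
  also have "prod h ?L = (\<Prod>e\<in>E. \<Prod>i\<in>UNIV. \<Prod>j\<in>UNIV. h (LineCoord e i j))"
    by (subst prod.reindex) (auto simp: inj_on_def prod.cartesian_product case_prod_unfold)
  finally show ?thesis .
qed

lemma span_singleton_eq_scale:
  fixes y z :: "'a::field ^ 'n::finite"
  assumes "vec.span {y} = vec.span {z}"
  shows "\<exists>c. c \<noteq> 0 \<and> z = c *s y"
proof (cases "y = 0")
  case True
  have "z \<in> vec.span {y}" unfolding assms by (simp add: vec.span_base)
  with True show ?thesis by (auto intro!: exI[of _ 1])
next
  case False
  have "z \<in> vec.span {y}" unfolding assms by (simp add: vec.span_base)
  then obtain c where c: "z = c *s y" by (auto simp: vec.span_singleton)
  have "y \<in> vec.span {z}" unfolding assms[symmetric] by (simp add: vec.span_base)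
  with c False have "c \<noteq> 0" by (auto simp: vec.span_singleton)
  with c show ?thesis by blast
qed

lemma span_pair: "x \<in> vec.span {u, w} \<Longrightarrow> \<exists>a b. x = a *s u + b *s (w :: 'a::field ^ 'n::finite)"
proof -
  assume "x \<in> vec.span {u, w}"
  then obtain a b where "x - a *s u = b *s w"
    by (auto simp: vec.span_breakdown_eq[of x u] vec.span_singleton)
  then have "x = a *s u + b *s w" by (metis diff_add_cancel add.commute)
  then show ?thesis by blast
qed

lemma pluecker_basis_change:
  "pluecker (a *s u + b *s w) (c *s u + d *s w) i j = (a * d - b * c) * pluecker u w i j"
  by (simp add: pluecker_def algebra_simps)

lemma pluecker_scale:
  fixes u w u' w' :: "'a::field ^ 'n::finite"
  assumes eq: "vec.span {u, w} = vec.span {u', w'}" and dim: "vec.dim (vec.span {u, w}) = 2"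
  shows "\<exists>c. c \<noteq> 0 \<and> (\<forall>i j. pluecker u' w' i j = c * pluecker u w i j)"
proof -
  have "u' \<in> vec.span {u, w}" "w' \<in> vec.span {u, w}"
    unfolding eq by (simp_all add: vec.span_base)
  then obtain a b c d where u': "u' = a *s u + b *s w" and w': "w' = c *s u + d *s w"
    using span_pair by metis
  have "a * d - b * c \<noteq> 0"
  proof
    assume 0: "a * d - b * c = 0"
    have "\<exists>z. {u', w'} \<subseteq> vec.span {z}"
    proof (cases "a = 0 \<and> b = 0")
      case True
      then have "u' = 0" by (simp add: u')
      then have "{u', w'} \<subseteq> vec.span {w'}"
        by (auto simp: vec.span_base vec.span_zero)
      then show ?thesis by blast
    next
      case False
      then obtain k where "c = k * a" "d = k * b"
      proof (cases "a = 0")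
        case True
        with False 0 show ?thesis by (intro that[of "d / b"]) auto
      next
        case False
        with 0 show ?thesis by (intro that[of "c / a"]) (auto simp: field_simps)
      qed
      then have "w' = k *s u'"
        by (simp add: u' w' vector_add_ldistrib)
      then have "{u', w'} \<subseteq> vec.span {u'}"
        by (auto simp: vec.span_base vec.span_scale)
      then show ?thesis by blast
    qed
    then obtain z where z: "{u', w'} \<subseteq> vec.span {z}" by blast
    have "vec.dim {u', w'} \<le> card {z}"
      by (rule vec.dim_le_card[OF z]) simp
    then show False using dim unfolding eq by simp
  qed
  then show ?thesis
    unfolding u' w' pluecker_basis_change by blast
qed

lemma homogeneous_coords_scale:
  assumes P: "P \<in> ambient V E" and x: "x \<in> homogeneous_coords V E P"
    and y: "y \<in> homogeneous_coords V E P"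
  shows "\<exists>s t. (\<forall>v\<in>V. s v \<noteq> 0 \<and> (\<forall>i. y (PointCoord v i) = s v * x (PointCoord v i))) \<and>
    (\<forall>e\<in>E. t e \<noteq> 0 \<and> (\<forall>i j. y (LineCoord e i j) = t e * x (LineCoord e i j)))"
proof -
  have "\<exists>c. c \<noteq> 0 \<and> (\<forall>i. y (PointCoord v i) = c * x (PointCoord v i))" if "v \<in> V" for v
  proof -
    have "vec.span {\<chi> i. x (PointCoord v i)} = vec.span {\<chi> i. y (PointCoord v i)}"
      using x y that by (auto simp: homogeneous_coords_def)
    from span_singleton_eq_scale[OF this] show ?thesis
      by (auto simp: vec_eq_iff)
  qed
  moreover have "\<exists>c. c \<noteq> 0 \<and> (\<forall>i j. y (LineCoord e i j) = c * x (LineCoord e i j))" if e: "e \<in> E" for e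
  proof -
    obtain u w where uw: "snd P e = vec.span {u, w}"
        "\<And>i j. x (LineCoord e i j) = pluecker u w i j"
      using x e unfolding homogeneous_coords_def by blast
    obtain u' w' where uw': "snd P e = vec.span {u', w'}"
        "\<And>i j. y (LineCoord e i j) = pluecker u' w' i j"
      using y e unfolding homogeneous_coords_def by blast
    have "vec.dim (vec.span {u, w}) = 2"
      unfolding uw(1)[symmetric] using P e by (auto simp: ambient_def proj_lines_def)
    moreover have "vec.span {u, w} = vec.span {u', w'}"
      using uw(1) uw'(1) by argo
    ultimately show ?thesis
      unfolding uw(2) uw'(2) by (intro pluecker_scale)
  qed
  ultimately show ?thesis by metis
qed

lemma multihomogeneous_vanish_iff:
  fixes f :: "(('v, 'n::finite) coord, 'a::field) mpoly"
  assumes fin: "finite V" "finite E" and f: "multihomogeneous V E f"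
    and P: "P \<in> ambient V E" and x: "x \<in> homogeneous_coords V E P"
    and y: "y \<in> homogeneous_coords V E P"
  shows "eval_mpoly x f = 0 \<longleftrightarrow> eval_mpoly y f = 0"
proof -
  obtain s t where s: "\<And>v. v \<in> V \<Longrightarrow> s v \<noteq> 0"
      "\<And>v i. v \<in> V \<Longrightarrow> y (PointCoord v i) = s v * x (PointCoord v i)"
    and t: "\<And>e. e \<in> E \<Longrightarrow> t e \<noteq> 0"
      "\<And>e i j. e \<in> E \<Longrightarrow> y (LineCoord e i j) = t e * x (LineCoord e i j)"
    using homogeneous_coords_scale[OF P x y] by blast
  obtain a b where f: "\<forall>m\<in>Poly_Mapping.keys f. Poly_Mapping.keys m \<subseteq> coords V E \<and>
     (\<forall>v\<in>V. (\<Sum>i\<in>UNIV. Poly_Mapping.lookup m (PointCoord v i)) = a v) \<and>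
     (\<forall>e\<in>E. (\<Sum>i\<in>UNIV. \<Sum>j\<in>UNIV. Poly_Mapping.lookup m (LineCoord e i j)) = b e)"
    using f unfolding multihomogeneous_def by blast
  define c where "c = (\<Prod>v\<in>V. s v ^ a v) * (\<Prod>e\<in>E. t e ^ b e)"
  have c: "c \<noteq> 0" using fin s t by (auto simp: c_def)
  have "(\<Prod>k\<in>Poly_Mapping.keys m. y k ^ Poly_Mapping.lookup m k) = c * (\<Prod>k\<in>Poly_Mapping.keys m. x k ^ Poly_Mapping.lookup m k)" if "m \<in> Poly_Mapping.keys f" for m
  proof -
    have m: "Poly_Mapping.keys m \<subseteq> coords V E"
      "\<And>v. v \<in> V \<Longrightarrow> (\<Sum>i\<in>UNIV. Poly_Mapping.lookup m (PointCoord v i)) = a v"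
      "\<And>e. e \<in> E \<Longrightarrow> (\<Sum>i\<in>UNIV. \<Sum>j\<in>UNIV. Poly_Mapping.lookup m (LineCoord e i j)) = b e"
      using f that by auto
    have "(\<Prod>v\<in>V. \<Prod>i\<in>UNIV. y (PointCoord v i) ^ Poly_Mapping.lookup m (PointCoord v i)) =
      (\<Prod>v\<in>V. s v ^ a v) * (\<Prod>v\<in>V. \<Prod>i\<in>UNIV. x (PointCoord v i) ^ Poly_Mapping.lookup m (PointCoord v i))"
      by (simp add: s(2) power_mult_distrib prod.distrib m(2)[symmetric] power_sum)
    moreover have "(\<Prod>e\<in>E. \<Prod>i\<in>UNIV. \<Prod>j\<in>UNIV. y (LineCoord e i j) ^ Poly_Mapping.lookup m (LineCoord e i j)) =
      (\<Prod>e\<in>E. t e ^ b e) *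
      (\<Prod>e\<in>E. \<Prod>i\<in>UNIV. \<Prod>j\<in>UNIV. x (LineCoord e i j) ^ Poly_Mapping.lookup m (LineCoord e i j))"
      by (simp add: t(2) power_mult_distrib prod.distrib m(3)[symmetric] power_sum)
    ultimately show ?thesis
      by (simp add: monomial_superset[OF finite_coords[OF fin] m(1)] prod_coords[OF fin] c_def)
  qed
  then have "eval_mpoly y f = c * eval_mpoly x f"
    by (simp add: eval_mpoly_def sum_distrib_left mult_ac)
  with c show ?thesis by simp
qed

lemma zero_locus_Un:
  assumes fin: "finite V" "finite E"
    and F: "\<forall>f\<in>F. multihomogeneous V E f" and G: "\<forall>g\<in>G. multihomogeneous V E g"
  shows "zero_locus V E F \<union> zero_locus V E G = zero_locus V E {f * g |f g. f \<in> F \<and> g \<in> G}"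
proof (intro equalityI subsetI)
  fix P assume "P \<in> zero_locus V E F \<union> zero_locus V E G"
  then show "P \<in> zero_locus V E {f * g |f g. f \<in> F \<and> g \<in> G}"
    by (auto simp: zero_locus_def eval_mpoly_mult)
next
  fix P assume P: "P \<in> zero_locus V E {f * g |f g. f \<in> F \<and> g \<in> G}"
  then have amb: "P \<in> ambient V E" by (simp add: zero_locus_def)
  show "P \<in> zero_locus V E F \<union> zero_locus V E G"
  proof (rule ccontr)
    assume "P \<notin> zero_locus V E F \<union> zero_locus V E G"
    then obtain f g x y where fg: "f \<in> F" "g \<in> G"
      and x: "x \<in> homogeneous_coords V E P" "eval_mpoly x f \<noteq> 0"
      and y: "y \<in> homogeneous_coords V E P" "eval_mpoly y g \<noteq> 0"
      using amb by (auto simp: zero_locus_def)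
    have "eval_mpoly x g \<noteq> 0"
      using multihomogeneous_vanish_iff[OF fin _ amb x(1) y(1), of g] G fg y(2) by blast
    moreover have "eval_mpoly x (f * g) = 0"
      using P fg x(1) by (auto simp: zero_locus_def)
    ultimately show False using x(2) by (simp add: eval_mpoly_mult)
  qed
qed

lemma istopology_zariski:
  assumes fin: "finite V" "finite E"
  shows "istopology (\<lambda>U :: ('v, 'a::field, 'n::finite) picture set. \<exists>F. (\<forall>f\<in>F. multihomogeneous V E f) \<and> U = ambient V E - zero_locus V E F)"
  unfolding istopology_def
proof (intro conjI allI impI)
  fix S T :: "('v, 'a, 'n) picture set"
  assume "\<exists>F. (\<forall>f\<in>F. multihomogeneous V E f) \<and> S = ambient V E - zero_locus V E F"
    and "\<exists>F. (\<forall>f\<in>F. multihomogeneous V E f) \<and> T = ambient V E - zero_locus V E F"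
  then obtain F G where F: "\<forall>f\<in>F. multihomogeneous V E f" "S = ambient V E - zero_locus V E F"
    and G: "\<forall>f\<in>G. multihomogeneous V E f" "T = ambient V E - zero_locus V E G"
    by blast
  have "S \<inter> T = ambient V E - zero_locus V E {f * g |f g. f \<in> F \<and> g \<in> G}"
    unfolding F(2) G(2) zero_locus_Un[OF fin F(1) G(1), symmetric] by blast
  moreover have "\<forall>h\<in>{f * g |f g. f \<in> F \<and> g \<in> G}. multihomogeneous V E h"
    using F(1) G(1) multihomogeneous_mult by blast
  ultimately show "\<exists>F. (\<forall>f\<in>F. multihomogeneous V E f) \<and> S \<inter> T = ambient V E - zero_locus V E F"
    by blast
next
  fix K :: "('v, 'a, 'n) picture set set"
  assume "\<forall>U\<in>K. \<exists>F. (\<forall>f\<in>F. multihomogeneous V E f) \<and> U = ambient V E - zero_locus V E F"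
  then obtain F where F: "\<And>U. U \<in> K \<Longrightarrow> \<forall>f\<in>F U. multihomogeneous V E f"
      "\<And>U. U \<in> K \<Longrightarrow> U = ambient V E - zero_locus V E (F U)"
    by metis
  have "\<Union>K = (\<Union>U\<in>K. ambient V E - zero_locus V E (F U))"
    using F(2) by auto
  also have "\<dots> = ambient V E - zero_locus V E (\<Union>U\<in>K. F U)"
    by (auto simp: zero_locus_def)
  finally show "\<exists>F. (\<forall>f\<in>F. multihomogeneous V E f) \<and> \<Union>K = ambient V E - zero_locus V E F"
    using F(1) by (intro exI[of _ "\<Union>U\<in>K. F U"]) auto
qed

lemma openin_zariski:
  assumes "finite V" "finite E"
  shows "openin (zariski V E) U \<longleftrightarrow>
    (\<exists>F. (\<forall>f\<in>F. multihomogeneous V E f) \<and> U = ambient V E - zero_locus V E F)"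
  unfolding zariski_def by (subst topology_inverse'[OF istopology_zariski[OF assms]]) (rule refl)

lemma homogeneous_coords_nonempty:
  assumes P: "P \<in> ambient V E"
  shows "homogeneous_coords V E P \<noteq> {}"
proof -
  have "\<exists>z. fst P v = vec.span {z}" if "v \<in> V" for v
  proof -
    have "vec.subspace (fst P v)" "vec.dim (fst P v) = 1"
      using P that by (auto simp: ambient_def proj_points_def)
    moreover obtain B where "B \<subseteq> fst P v" "vec.independent B" "fst P v \<subseteq> vec.span B"
        "card B = vec.dim (fst P v)"
      using vec.basis_exists by blast
    ultimately show ?thesis
      by (metis card_1_singletonE vec.span_subspace)
  qed
  then obtain z where z: "\<And>v. v \<in> V \<Longrightarrow> fst P v = vec.span {z v}" by metis
  have "\<exists>u w. snd P e = vec.span {u, w}" if "e \<in> E" for e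
  proof -
    have "vec.subspace (snd P e)" "vec.dim (snd P e) = 2"
      using P that by (auto simp: ambient_def proj_lines_def)
    moreover obtain B where "B \<subseteq> snd P e" "vec.independent B" "snd P e \<subseteq> vec.span B"
        "card B = vec.dim (snd P e)"
      using vec.basis_exists by blast
    ultimately show ?thesis
      by (metis card_2_iff vec.span_subspace)
  qed
  then obtain u w where uw: "\<And>e. e \<in> E \<Longrightarrow> snd P e = vec.span {u e, w e}" by metis
  define x where "x = (\<lambda>k. case k of PointCoord v i \<Rightarrow> z v $ i | LineCoord e i j \<Rightarrow> pluecker (u e) (w e) i j)"
  have "x \<in> homogeneous_coords V E P"
    unfolding homogeneous_coords_def using z uw by (auto simp: x_def)
  then show ?thesis by blast
qed

lemma topspace_zariski:
  assumes "finite V" "finite E"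
  shows "topspace (zariski V E) = ambient V E"
proof
  show "topspace (zariski V E) \<subseteq> ambient V E"
    by (auto simp: topspace_def openin_zariski[OF assms])
  have "zero_locus V E {1} = {}"
    using homogeneous_coords_nonempty by (auto simp: zero_locus_def)
  then have "openin (zariski V E) (ambient V E)"
    unfolding openin_zariski[OF assms] by (intro exI[of _ "{1}"]) (auto simp: multihomogeneous_1)
  then show "ambient V E \<subseteq> topspace (zariski V E)"
    by (rule openin_subset)
qed

lemma closedin_zariski:
  assumes "finite V" "finite E"
  shows "closedin (zariski V E) C \<longleftrightarrow>
    (\<exists>F. (\<forall>f\<in>F. multihomogeneous V E f) \<and> C = zero_locus V E F)"
proof -
  have "zero_locus V E F \<subseteq> ambient V E" for F
    by (auto simp: zero_locus_def)
  then show ?thesis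
    unfolding closedin_def openin_zariski[OF assms] topspace_zariski[OF assms]
    by (metis Diff_Diff_Int Int_absorb1)
qed

end

theory Submission
  imports Defs
begin

text \<open>
  A picture in the cellule of \<open>\<pi>\<close> is given by a vector for each block of \<open>\<pi>\<close> and a second spanning
  vector for the line of each edge inside a block; the other lines are spanned by their endpoints.
  Along the segment joining two such parameters all nondegeneracy conditions and all multihomogeneous
  equations are univariate polynomials. So if two equations are violated at one endpoint each, then
  over an infinite field both are violated at some common point of the segment that again
  parametrizes a picture in the cellule. Hence every cellule is irreducible, and the picture space
  is the union of the finitely many cellules.
\<close>

section \<open>Irreducible sets\<close>

text \<open>A closed set contains \<open>S\<close> exactly when it contains the closure, so a closed
  cover of the closure can be tested on \<open>S\<close>.\<close>

lemma irreducible_in_closure: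
  assumes "irreducible_in X S"
  shows "irreducible_in X (X closure_of S)"
proof -
  have S: "S \<subseteq> X closure_of S"
    using assms by (simp add: irreducible_in_def closure_of_subset)
  then have "X closure_of S \<subseteq> C \<or> X closure_of S \<subseteq> D"
    if "closedin X C" "closedin X D" "X closure_of S \<subseteq> C \<union> D" for C D
    using assms that unfolding irreducible_in_def
    by (meson closure_of_minimal subset_trans)
  with S assms show ?thesis
    unfolding irreducible_in_def by (auto simp: closure_of_subset_topspace)
qed

text \<open>Induction splits off one closed set at a time; the empty cover is ruled out because
  irreducible sets are nonempty.\<close>

lemma irreducible_in_finite_Union:
  assumes "finite \<C>" "irreducible_in X S" "\<And>C. C \<in> \<C> \<Longrightarrow> closedin X C" "S \<subseteq> \<Union>\<C>"
  shows "\<exists>C\<in>\<C>. S \<subseteq> C"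
  using assms
proof (induction \<C> rule: finite_induct)
  case empty
  then show ?case by (auto simp: irreducible_in_def)
next
  case (insert C \<C>)
  have "closedin X (\<Union>\<C>)" using insert by (intro closedin_Union) auto
  then have "S \<subseteq> C \<or> S \<subseteq> \<Union>\<C>"
    using insert.prems unfolding irreducible_in_def by simp
  then show ?case using insert by auto
qed

text \<open>The closures of the members of \<open>\<A>\<close> are irreducible, and finitely many of
  them cover the space, so every irreducible set lies inside one of them. Maximality among all
  irreducible sets is therefore maximality among these closures.\<close>

lemma irreducible_components_finite_cover:
  assumes fin: "finite \<A>" and irr: "\<And>A. A \<in> \<A> \<Longrightarrow> irreducible_in X A"
    and cover: "topspace X = \<Union>\<A>"
  shows "irreducible_components X = maximal_sets ((closure_of) X ` \<A>)"
proof -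
  have irr': "irreducible_in X C" if "C \<in> (closure_of) X ` \<A>" for C
    using that irr by (auto intro: irreducible_in_closure)
  have ex: "\<exists>C\<in>(closure_of) X ` \<A>. S \<subseteq> C" if "irreducible_in X S" for S
  proof (rule irreducible_in_finite_Union[OF _ that])
    have "\<Union>\<A> \<subseteq> \<Union>((closure_of) X ` \<A>)"
      using irr by (fastforce simp: irreducible_in_def dest: closure_of_subset)
    then show "S \<subseteq> \<Union>((closure_of) X ` \<A>)"
      using that cover unfolding irreducible_in_def by (metis subset_trans)
  qed (use fin in \<open>auto\<close>)
  show ?thesis
  proof (intro equalityI subsetI)
    fix S assume S: "S \<in> irreducible_components X"
    then have "irreducible_in X S" by (simp add: irreducible_components_def)
    then obtain C where "C \<in> (closure_of) X ` \<A>" "S \<subseteq> C"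
      using ex by blast
    with S show "S \<in> maximal_sets ((closure_of) X ` \<A>)"
      using irr' unfolding irreducible_components_def maximal_sets_def by blast
  next
    fix S assume S: "S \<in> maximal_sets ((closure_of) X ` \<A>)"
    \<comment> \<open>\<open>T\<close> is squeezed between \<open>S\<close> and a closure
      \<open>C\<close>, and maximality of \<open>S\<close> forces \<open>C = S\<close>.\<close>
    have "T = S" if T: "irreducible_in X T" "S \<subseteq> T" for T
    proof -
      obtain C where "C \<in> (closure_of) X ` \<A>" "T \<subseteq> C"
        using ex[OF T(1)] by blast
      with S T(2) show ?thesis unfolding maximal_sets_def by blast
    qed
    with S irr' show "S \<in> irreducible_components X"
      unfolding irreducible_components_def maximal_sets_def by blast
  qed
qed

section \<open>Polynomial functions of one variable\<close>

text \<open>A property of functions, so that composite expressions are handled by introduction rules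
  without ever writing down the polynomial.\<close>

definition polynomial_fun :: "('a::comm_ring_1 \<Rightarrow> 'a) \<Rightarrow> bool" where
  "polynomial_fun h \<longleftrightarrow> (\<exists>p. \<forall>t. h t = poly p t)"

lemma polynomial_fun_const: "polynomial_fun (\<lambda>t. c)"
  unfolding polynomial_fun_def by (intro exI[of _ "[:c:]"]) auto

lemma polynomial_fun_id: "polynomial_fun (\<lambda>t. t)"
  unfolding polynomial_fun_def by (intro exI[of _ "[:0, 1:]"]) auto

lemma polynomial_fun_add: "polynomial_fun g \<Longrightarrow> polynomial_fun h \<Longrightarrow> polynomial_fun (\<lambda>t. g t + h t)"
  unfolding polynomial_fun_def by (metis poly_add)

lemma polynomial_fun_diff: "polynomial_fun g \<Longrightarrow> polynomial_fun h \<Longrightarrow> polynomial_fun (\<lambda>t. g t - h t)"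
  unfolding polynomial_fun_def by (metis poly_diff)

lemma polynomial_fun_mult: "polynomial_fun g \<Longrightarrow> polynomial_fun h \<Longrightarrow> polynomial_fun (\<lambda>t. g t * h t)"
  unfolding polynomial_fun_def by (metis poly_mult)

lemma polynomial_fun_power: "polynomial_fun g \<Longrightarrow> polynomial_fun (\<lambda>t. g t ^ n)"
  unfolding polynomial_fun_def by (metis poly_power)

lemma polynomial_fun_sum:
  "(\<And>i. i \<in> I \<Longrightarrow> polynomial_fun (h i)) \<Longrightarrow> polynomial_fun (\<lambda>t. \<Sum>i\<in>I. h i t)"
  by (induction I rule: infinite_finite_induct)
    (auto intro: polynomial_fun_const polynomial_fun_add)

lemma polynomial_fun_prod:
  "(\<And>i. i \<in> I \<Longrightarrow> polynomial_fun (h i)) \<Longrightarrow> polynomial_fun (\<lambda>t. \<Prod>i\<in>I. h i t)"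
  by (induction I rule: infinite_finite_induct)
    (auto intro: polynomial_fun_const polynomial_fun_mult)

lemmas polynomial_fun_intros = polynomial_fun_const polynomial_fun_id polynomial_fun_add
  polynomial_fun_diff polynomial_fun_mult polynomial_fun_power polynomial_fun_sum polynomial_fun_prod

lemma polynomial_fun_eval_mpoly:
  assumes "\<And>k. polynomial_fun (\<lambda>t. x t k)"
  shows "polynomial_fun (\<lambda>t. eval_mpoly (x t) f)"
  unfolding eval_mpoly_def by (intro polynomial_fun_intros assms)

text \<open>One nonzero value shows that the representing polynomial is nonzero, hence has finitely
  many roots.\<close>

lemma finite_zeros_polynomial_fun:
  fixes h :: "'a::idom \<Rightarrow> 'a"
  assumes "polynomial_fun h" "h s \<noteq> 0"
  shows "finite {t. h t = 0}"
proof -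
  obtain p where "\<And>t. h t = poly p t" using assms(1) by (auto simp: polynomial_fun_def)
  with assms(2) show ?thesis by (auto intro!: poly_roots_finite)
qed

text \<open>Euclid's argument: over a finite field, the product of all X - a, plus 1, has positive
  degree but takes the value 1 everywhere.\<close>

lemma infinite_UNIV_alg_closed: "infinite (UNIV :: 'a::alg_closed_field set)"
proof
  assume fin: "finite (UNIV :: 'a set)"
  let ?p = "(\<Prod>a\<in>UNIV. [:- a, 1:]) + (1 :: 'a poly)"
  have "degree (\<Prod>a\<in>UNIV. [:- a, 1 :: 'a:]) = card (UNIV :: 'a set)"
    by (subst degree_prod_eq_sum_degree) auto
  moreover have "card (UNIV :: 'a set) > 0" using fin by (simp add: card_gt_0_iff)
  ultimately have "degree ?p > 0" by (subst degree_add_eq_left) auto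
  then obtain z where "poly ?p z = 0" using alg_closed_imp_poly_has_root by blast
  moreover have "(\<Prod>a\<in>UNIV. poly [:- a, 1:] z) = 0"
    using fin by (intro prod_zero) auto
  ultimately show False by (simp add: poly_prod)
qed

section \<open>Points and lines\<close>

text \<open>The vanishing 2x2 minors that involve a nonzero entry of \<open>u\<close> determine
  every entry of \<open>w\<close>.\<close>

lemma pluecker_zero_imp_scale:
  fixes u w :: "'a::field ^ 'n::finite"
  assumes "u \<noteq> 0" "\<And>i j. pluecker u w i j = 0"
  shows "\<exists>c. w = c *s u"
proof -
  obtain i where "u $ i \<noteq> 0" using assms(1) by (auto simp: vec_eq_iff)
  then have "w = (w $ i / u $ i) *s u"
    using assms(2)[of i] by (auto simp: vec_eq_iff pluecker_def field_simps)
  then show ?thesis by blast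
qed

text \<open>The rank criterion by 2x2 minors. It turns independence into the non-vanishing of a
  polynomial, a condition that can be followed along a segment.\<close>

lemma dim_pair_eq_2_iff:
  fixes u w :: "'a::field ^ 'n::finite"
  shows "vec.dim {u, w} = 2 \<longleftrightarrow> (\<exists>i j. pluecker u w i j \<noteq> 0)"
proof
  assume dim: "vec.dim {u, w} = 2"
  show "\<exists>i j. pluecker u w i j \<noteq> 0"
  proof (rule ccontr)
    assume neg: "\<not> (\<exists>i j. pluecker u w i j \<noteq> 0)"
    have "\<exists>z. {u, w} \<subseteq> vec.span {z}"
    proof (cases "u = 0")
      case True
      then show ?thesis by (auto intro!: exI[of _ w] simp: vec.span_base vec.span_zero)
    next
      case False
      then obtain c where "w = c *s u" using pluecker_zero_imp_scale neg by blast
      then show ?thesis by (auto intro!: exI[of _ u] simp: vec.span_base vec.span_scale)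
    qed
    then obtain z where "{u, w} \<subseteq> vec.span {z}" by blast
    from vec.dim_le_card[OF this] dim show False by simp
  qed
next
  assume "\<exists>i j. pluecker u w i j \<noteq> 0"
  then obtain i j where ij: "pluecker u w i j \<noteq> 0" by blast
  then have "w \<noteq> 0" "u \<noteq> w" "u \<noteq> k *s w" for k
    by (auto simp: pluecker_def)
  then have "vec.independent {u, w}"
    by (auto simp: vec.independent_insert vec.span_singleton)
  with \<open>u \<noteq> w\<close> show "vec.dim {u, w} = 2"
    by (simp add: vec.dim_eq_card_independent)
qed

lemma span_scale_eq:
  fixes u :: "'a::field ^ 'n::finite"
  assumes "c \<noteq> 0"
  shows "vec.span {c *s u} = vec.span {u}"
proof (intro equalityI vec.span_minimal)
  have "inverse c *s (c *s u) \<in> vec.span {c *s u}"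
    by (intro vec.span_scale vec.span_base) simp
  then show "{u} \<subseteq> vec.span {c *s u}" using assms by simp
qed (auto simp: vec.span_base vec.span_scale)

lemma span_singleton_eq_iff_pluecker:
  fixes u w :: "'a::field ^ 'n::finite"
  assumes "u \<noteq> 0" "w \<noteq> 0"
  shows "vec.span {u} = vec.span {w} \<longleftrightarrow> (\<forall>i j. pluecker u w i j = 0)"
proof
  assume "vec.span {u} = vec.span {w}"
  then obtain c where "w = c *s u" using span_singleton_eq_scale by blast
  then show "\<forall>i j. pluecker u w i j = 0" by (simp add: pluecker_def)
next
  assume "\<forall>i j. pluecker u w i j = 0"
  then obtain c where "w = c *s u" using pluecker_zero_imp_scale assms(1) by blast
  moreover from this assms(2) have "c \<noteq> 0" by auto
  ultimately show "vec.span {u} = vec.span {w}" by (simp add: span_scale_eq)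
qed

lemma span_singleton_in_proj_points:
  fixes u :: "'a::field ^ 'n::finite"
  assumes "u \<noteq> 0"
  shows "vec.span {u} \<in> proj_points"
  using assms by (simp add: proj_points_def vec.dim_eq_card_independent)

lemma proj_pointsE:
  fixes p :: "('a::field ^ 'n::finite) set"
  assumes "p \<in> proj_points"
  obtains u where "u \<noteq> 0" "p = vec.span {u}"
proof -
  have p: "vec.subspace p" "vec.dim p = 1"
    using assms by (auto simp: proj_points_def)
  obtain B where "B \<subseteq> p" "vec.independent B" "p \<subseteq> vec.span B" "card B = vec.dim p"
    using vec.basis_exists by blast
  then obtain u where "vec.independent {u}" "p = vec.span {u}"
    using p by (metis card_1_singletonE vec.span_subspace)
  with that show thesis by (auto simp: vec.dependent_single)
qed

lemma line_eq_span:
  fixes l :: "('a::field ^ 'n::finite) set"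
  assumes l: "l \<in> proj_lines" and uw: "u \<in> l" "w \<in> l" "\<exists>i j. pluecker u w i j \<noteq> 0"
  shows "l = vec.span {u, w}"
proof -
  have "vec.span {u, w} = vec.span l"
    using assms by (intro vec.dim_eq_span) (auto simp: proj_lines_def simp flip: dim_pair_eq_2_iff)
  moreover have "vec.span l = l"
    using l by (simp add: proj_lines_def)
  ultimately show ?thesis by simp
qed

text \<open>Otherwise every vector of \<open>l\<close> would be a multiple of \<open>u\<close>,
  contradicting dimension 2.\<close>

lemma line_second_vector:
  fixes l :: "('a::field ^ 'n::finite) set"
  assumes l: "l \<in> proj_lines" and u: "u \<in> l" "u \<noteq> 0"
  obtains w where "w \<in> l" "\<exists>i j. pluecker u w i j \<noteq> 0"
proof (rule ccontr)
  assume "\<not> thesis"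
  with that u(2) have "l \<subseteq> vec.span {u}"
    using pluecker_zero_imp_scale by (fastforce simp: vec.span_singleton)
  from vec.dim_le_card[OF this] l show False by (simp add: proj_lines_def)
qed

section \<open>Segments of vectors\<close>

text \<open>This is the affine line through two families of vectors, with \<open>t\<close> ranging
  over the whole field. The index type is generic because the same formula serves vertices and
  edges.\<close>

definition segment_param ::
    "('i \<Rightarrow> 'a::field ^ 'n::finite) \<Rightarrow> ('i \<Rightarrow> 'a ^ 'n) \<Rightarrow> 'a \<Rightarrow> 'i \<Rightarrow> 'a ^ 'n" where
  "segment_param x x' t k = (1 - t) *s x k + t *s x' k"

lemma segment_param_0 [simp]: "segment_param x x' 0 = x"
  and segment_param_1 [simp]: "segment_param x x' 1 = x'"
  by (auto simp: segment_param_def fun_eq_iff)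

lemma polynomial_fun_segment_param: "polynomial_fun (\<lambda>t. segment_param x x' t k $ i)"
  unfolding segment_param_def by (simp, intro polynomial_fun_intros)

lemma polynomial_fun_pluecker_segment:
  "polynomial_fun (\<lambda>t. pluecker (segment_param x x' t k) (segment_param y y' t l) i j)"
  unfolding pluecker_def by (intro polynomial_fun_intros polynomial_fun_segment_param)

text \<open>A coordinate that is nonzero at \<open>t = 0\<close> already vanishes for only finitely
  many \<open>t\<close>; the end at \<open>t = 1\<close> is arbitrary.\<close>

lemma finite_pluecker_segment_zero:
  assumes "\<exists>i j. pluecker (x k) (y l) i j \<noteq> 0"
  shows "finite {t. \<forall>i j. pluecker (segment_param x x' t k) (segment_param y y' t l) i j = 0}"
proof -
  obtain i j where "pluecker (x k) (y l) i j \<noteq> 0" using assms by blast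
  then have "finite {t. pluecker (segment_param x x' t k) (segment_param y y' t l) i j = 0}"
    by (intro finite_zeros_polynomial_fun[where s = 0] polynomial_fun_pluecker_segment) simp
  then show ?thesis by (rule rev_finite_subset) auto
qed

section \<open>Parametrizing a cellule\<close>

text \<open>
  Each edge \<open>e\<close> is oriented as \<open>{a e, b e}\<close>; its line is spanned by the vectors \<open>x (a e)\<close> and \<open>y e\<close>.
\<close>

locale oriented_graph =
  fixes V :: "'v set" and E :: "'v set set" and a b :: "'v set \<Rightarrow> 'v" and \<pi> :: "'v set set"
  assumes fin: "finite V" "finite E"
    and ends: "\<And>e. e \<in> E \<Longrightarrow> e = {a e, b e}" "\<And>e. e \<in> E \<Longrightarrow> a e \<in> V" "\<And>e. e \<in> E \<Longrightarrow> b e \<in> V"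
    and partition: "partition_on V \<pi>"
begin

text \<open>Only linear equations and non-vanishing conditions occur, since segments preserve the
  former and break the latter at finitely many parameters only. This is why vertices of one block
  carry equal vectors, not just proportional ones, and why \<open>y e\<close> is exactly
  \<open>x (b e)\<close> for an edge between different blocks.\<close>

definition admissible :: "('v \<Rightarrow> 'a::field ^ 'n::finite) \<Rightarrow> ('v set \<Rightarrow> 'a ^ 'n) \<Rightarrow> bool" where
  "admissible x y \<longleftrightarrow>
     (\<forall>v\<in>V. x v \<noteq> 0) \<and>
     (\<forall>v\<in>V. \<forall>w\<in>V. if same_block \<pi> v w then x v = x w else \<exists>i j. pluecker (x v) (x w) i j \<noteq> 0) \<and>
     (\<forall>e\<in>E. (\<exists>i j. pluecker (x (a e)) (y e) i j \<noteq> 0) \<and>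
       (same_block \<pi> (a e) (b e) \<or> y e = x (b e)))"

definition param_picture ::
    "('v \<Rightarrow> 'a::field ^ 'n::finite) \<Rightarrow> ('v set \<Rightarrow> 'a ^ 'n) \<Rightarrow> ('v, 'a, 'n) picture" where
  "param_picture x y =
     (restrict (\<lambda>v. vec.span {x v}) V, restrict (\<lambda>e. vec.span {x (a e), y e}) E)"

definition param_coords ::
    "('v \<Rightarrow> 'a::field ^ 'n::finite) \<Rightarrow> ('v set \<Rightarrow> 'a ^ 'n) \<Rightarrow> ('v, 'n) coord \<Rightarrow> 'a" where
  "param_coords x y k = (case k of PointCoord v i \<Rightarrow> x v $ i
     | LineCoord e i j \<Rightarrow> pluecker (x (a e)) (y e) i j)"

lemma param_coords_in_homogeneous_coords:
  "param_coords x y \<in> homogeneous_coords V E (param_picture x y)"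
  by (auto simp: homogeneous_coords_def param_picture_def param_coords_def)

lemma param_picture_in_cellule:
  assumes "admissible x y"
  shows "param_picture x y \<in> cellule V E \<pi>"
proof -
  have ne: "x v \<noteq> 0" if "v \<in> V" for v
    using assms that by (simp add: admissible_def)
  have same: "same_block \<pi> v w \<Longrightarrow> x v = x w"
    and diff: "\<not> same_block \<pi> v w \<Longrightarrow> \<exists>i j. pluecker (x v) (x w) i j \<noteq> 0"
    if "v \<in> V" "w \<in> V" for v w
    using assms that unfolding admissible_def by metis+
  have line: "vec.span {x (a e), y e} \<in> proj_lines" if "e \<in> E" for e
    using assms that by (auto simp: proj_lines_def dim_pair_eq_2_iff admissible_def)
  \<comment> \<open>The second endpoint lies on the line in either case: it shares the vector of the
    first one inside a block, and otherwise its vector is \<open>y e\<close>.\<close>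
  have b: "x (b e) \<in> {x (a e), y e}" if "e \<in> E" for e
    using assms that same[OF ends(2)[OF that] ends(3)[OF that]] unfolding admissible_def by auto
  have "vec.span {x v} \<subseteq> vec.span {x (a e), y e}" if "e \<in> E" "v \<in> e" for v e
  proof -
    have "v = a e \<or> v = b e" using ends(1)[OF that(1)] that(2) by blast
    then show ?thesis using b[OF that(1)] by (intro vec.span_mono) auto
  qed
  moreover have "v \<in> V" if "e \<in> E" "v \<in> e" for v e
    using ends[OF that(1)] that(2) by (metis insertE singletonD)
  ultimately have "param_picture x y \<in> picture_space V E"
    using ne line
    by (auto simp: picture_space_def ambient_def param_picture_def span_singleton_in_proj_points)
  moreover have "vec.span {x v} = vec.span {x w} \<longleftrightarrow> same_block \<pi> v w" if "v \<in> V" "w \<in> V" for v w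
    using same[OF that] diff[OF that] span_singleton_eq_iff_pluecker[OF ne ne, OF that] by auto
  ultimately show ?thesis
    by (auto simp: cellule_def param_picture_def)
qed

text \<open>The parametrization is onto the cellule, so statements about pictures can be tested on
  admissible vectors.\<close>

lemma cellule_param:
  fixes P :: "('v, 'a::field, 'n::finite) picture"
  assumes P: "P \<in> cellule V E \<pi>"
  obtains x y where "admissible x y" "P = param_picture x y"
proof -
  have amb: "fst P \<in> V \<rightarrow>\<^sub>E proj_points" "snd P \<in> E \<rightarrow>\<^sub>E proj_lines"
    using P by (auto simp: cellule_def picture_space_def ambient_def)
  have inc: "fst P v \<subseteq> snd P e" if "e \<in> E" "v \<in> e" for v e
    using P that by (auto simp: cellule_def picture_space_def)
  have block: "fst P v = fst P w \<longleftrightarrow> same_block \<pi> v w" if "v \<in> V" "w \<in> V" for v w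
    using P that by (auto simp: cellule_def)
  have "\<forall>p\<in>proj_points. \<exists>u :: 'a ^ 'n. u \<noteq> 0 \<and> p = vec.span {u}"
    using proj_pointsE by metis
  then obtain z where z: "\<And>p. p \<in> proj_points \<Longrightarrow> z p \<noteq> (0 :: 'a ^ 'n) \<and> p = vec.span {z p}"
    by metis
  \<comment> \<open>The representative depends on the point, not on the vertex, so vertices at the
    same point get equal vectors.\<close>
  define x where "x = (\<lambda>v. z (fst P v))"
  have x: "x v \<noteq> 0" "fst P v = vec.span {x v}" if "v \<in> V" for v
    using z[of "fst P v"] amb(1) that by (auto simp: x_def)
  have same: "x v = x w" if "v \<in> V" "w \<in> V" "same_block \<pi> v w" for v w
    using block[OF that(1,2)] that(3) by (simp add: x_def)
  have diff: "\<exists>i j. pluecker (x v) (x w) i j \<noteq> 0" if "v \<in> V" "w \<in> V" "\<not> same_block \<pi> v w" for v w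
    using block[OF that(1,2)] that(3) span_singleton_eq_iff_pluecker[OF x(1) x(1), OF that(1,2)]
      x(2) that(1,2) by auto
  have "\<exists>w. snd P e = vec.span {x (a e), w} \<and> (\<exists>i j. pluecker (x (a e)) w i j \<noteq> 0) \<and>
      (same_block \<pi> (a e) (b e) \<or> w = x (b e))" if e: "e \<in> E" for e
  proof -
    have V: "a e \<in> V" "b e \<in> V" using ends e by auto
    have l: "snd P e \<in> proj_lines" using amb(2) e by auto
    have "x v \<in> snd P e" if "v \<in> e" "v \<in> V" for v
      using inc[OF e that(1)] x(2)[OF that(2)] vec.span_base[of "x v" "{x v}"] by auto
    moreover have "a e \<in> e" "b e \<in> e" using ends(1)[OF e] by blast+
    ultimately have xin: "x (a e) \<in> snd P e" "x (b e) \<in> snd P e" using V by blast+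
    show ?thesis
    \<comment> \<open>Inside a block the line is any line through the common point and needs some
      second vector; between blocks it is forced by its two distinct endpoints.\<close>
    proof (cases "same_block \<pi> (a e) (b e)")
      case True
      obtain w where "w \<in> snd P e" "\<exists>i j. pluecker (x (a e)) w i j \<noteq> 0"
        using line_second_vector[OF l xin(1) x(1)[OF V(1)]] by blast
      with True line_eq_span[OF l xin(1)] show ?thesis by blast
    next
      case False
      with diff V line_eq_span[OF l xin] show ?thesis by blast
    qed
  qed
  then obtain y where y: "\<And>e. e \<in> E \<Longrightarrow> snd P e = vec.span {x (a e), y e} \<and>
      (\<exists>i j. pluecker (x (a e)) (y e) i j \<noteq> 0) \<and> (same_block \<pi> (a e) (b e) \<or> y e = x (b e))"
    by metis
  show thesis
  proof
    show "admissible x y"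
      using x(1) same diff y by (auto simp: admissible_def)
    have "fst P = restrict (\<lambda>v. vec.span {x v}) V" "snd P = restrict (\<lambda>e. vec.span {x (a e), y e}) E"
      using amb x(2) y by (auto simp: fun_eq_iff PiE_def extensional_def)
    then show "P = param_picture x y"
      by (simp add: param_picture_def prod_eq_iff)
  qed
qed

text \<open>The blocks are placed at distinct points (1 : c) of one coordinate line, which also
  serves as the line of every edge. This supplies the non-emptiness demanded by
  irreducibility.\<close>

lemma cellule_nonempty:
  assumes inf: "infinite (UNIV :: 'a::field set)" and card: "CARD('n::finite) \<ge> 2"
  shows "cellule V E \<pi> \<noteq> ({} :: ('v, 'a, 'n) picture set)"
proof -
  obtain i j :: 'n where ij: "i \<noteq> j"
    using card card_le_Suc0_iff_eq[of "UNIV :: 'n set"] by auto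
  have "finite \<pi>" using fin(1) partition by (rule finite_elements)
  \<comment> \<open>Finitely many blocks can be labelled by distinct scalars of an infinite
    field.\<close>
  then obtain c :: "'v set \<Rightarrow> 'a" where c: "inj_on c \<pi>"
    using inf by (meson finite_imp_inj_to_nat_seg infinite_iff_countable_subset comp_inj_on inj_on_subset subset_UNIV)
  have block: "\<exists>!B. B \<in> \<pi> \<and> v \<in> B" if "v \<in> V" for v
    using partition that partition_onD1 partition_onD2 by (metis UnionE disjointD disjoint_iff)
  define B where "B = (\<lambda>v. THE B. B \<in> \<pi> \<and> v \<in> B)"
  have B: "B v \<in> \<pi>" "v \<in> B v" if "v \<in> V" for v
    using theI'[OF block[OF that]] by (auto simp: B_def)
  have same: "same_block \<pi> v w \<longleftrightarrow> c (B v) = c (B w)" if "v \<in> V" "w \<in> V" for v w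
    using B[OF that(1)] B[OF that(2)] block[OF that(1)] block[OF that(2)] c
    unfolding same_block_def by (metis inj_onD)
  define x :: "'v \<Rightarrow> 'a ^ 'n" where "x = (\<lambda>v. \<chi> k. if k = i then 1 else if k = j then c (B v) else 0)"
  \<comment> \<open>Inside a block the point at infinity of the coordinate line is a safe second
    vector: its \<open>i\<close>-th entry is 0, whereas that of each \<open>x v\<close> is
    1.\<close>
  define y where "y = (\<lambda>e. if same_block \<pi> (a e) (b e) then axis j 1 else x (b e))"
  have "pluecker (x v) (x w) i j = c (B w) - c (B v)" for v w
    using ij by (simp add: pluecker_def x_def)
  then have diff: "\<exists>i j. pluecker (x v) (x w) i j \<noteq> 0" if "v \<in> V" "w \<in> V" "\<not> same_block \<pi> v w" for v w
    using that same by (intro exI[of _ i] exI[of _ j]) simp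
  have "pluecker (x v) (axis j 1) i j = 1" for v
    using ij by (simp add: pluecker_def x_def axis_def)
  then have "\<exists>k l. pluecker (x v) (axis j 1) k l \<noteq> 0" for v
    by (metis zero_neq_one)
  with diff have "\<exists>i j. pluecker (x (a e)) (y e) i j \<noteq> 0" if "e \<in> E" for e
    unfolding y_def using ends(2,3)[OF that] by (cases "same_block \<pi> (a e) (b e)") simp_all
  moreover have "x v \<noteq> 0" for v
    by (auto simp: x_def vec_eq_iff)
  moreover have "x v = x w" if "v \<in> V" "w \<in> V" "same_block \<pi> v w" for v w
  proof -
    have "c (B v) = c (B w)" using same that by blast
    then show ?thesis unfolding x_def by (rule arg_cong)
  qed
  moreover note diff
  ultimately have "admissible x y"
    unfolding admissible_def by (simp add: y_def)
  then show ?thesis using param_picture_in_cellule by blast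
qed

section \<open>Irreducibility of a cellule by means of segments\<close>

lemma polynomial_fun_param_coords_segment:
  "polynomial_fun (\<lambda>t. param_coords (segment_param x x' t) (segment_param y y' t) k)"
  unfolding param_coords_def
  by (cases k) (simp_all add: polynomial_fun_segment_param polynomial_fun_pluecker_segment)

text \<open>The linear equations hold at both ends, hence on the whole segment. Each of the finitely
  many non-vanishing conditions holds at \<open>t = 0\<close> and so fails for only finitely many
  \<open>t\<close>; \<open>?bad\<close> collects these failures.\<close>

lemma finite_not_admissible_segment:
  assumes adm: "admissible x y" "admissible x' y'"
  shows "finite {t. \<not> admissible (segment_param x x' t) (segment_param y y' t)}"
proof -
  let ?x = "segment_param x x'" and ?y = "segment_param y y'"
  let ?D = "{(v, w) \<in> V \<times> V. \<not> same_block \<pi> v w}"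
  let ?bad = "(\<Union>v\<in>V. {t. ?x t v = 0}) \<union>
    (\<Union>(v, w)\<in>?D. {t. \<forall>i j. pluecker (?x t v) (?x t w) i j = 0}) \<union>
    (\<Union>e\<in>E. {t. \<forall>i j. pluecker (?x t (a e)) (?y t e) i j = 0})"
  have "finite {t. ?x t v = 0}" if v: "v \<in> V" for v
  proof -
    have "x v \<noteq> 0" using adm(1) v by (simp add: admissible_def)
    then obtain i where "x v $ i \<noteq> 0" by (auto simp: vec_eq_iff)
    then have "finite {t. ?x t v $ i = 0}"
      by (intro finite_zeros_polynomial_fun[where s = 0] polynomial_fun_segment_param) simp
    then show ?thesis by (rule rev_finite_subset) auto
  qed
  moreover have "finite {t. \<forall>i j. pluecker (?x t v) (?x t w) i j = 0}" if "(v, w) \<in> ?D" for v w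
    using adm(1) that unfolding admissible_def
    by (intro finite_pluecker_segment_zero) auto
  moreover have "finite {t. \<forall>i j. pluecker (?x t (a e)) (?y t e) i j = 0}" if "e \<in> E" for e
    using adm(1) that unfolding admissible_def
    by (intro finite_pluecker_segment_zero) auto
  moreover have "finite ?D" by (rule finite_subset[of _ "V \<times> V"]) (use fin in auto)
  ultimately have fin_bad: "finite ?bad"
    using fin by (intro finite_UnI finite_UN_I) auto
  have "admissible (?x t) (?y t)" if t: "t \<notin> ?bad" for t
  proof -
    have "?x t v = ?x t w" if "v \<in> V" "w \<in> V" "same_block \<pi> v w" for v w
    proof -
      have "x v = x w" "x' v = x' w"
        using adm that unfolding admissible_def by metis+
      then show ?thesis by (simp add: segment_param_def)
    qed
    moreover have "?y t e = ?x t (b e)" if "e \<in> E" "\<not> same_block \<pi> (a e) (b e)" for e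
    proof -
      have "y e = x (b e)" "y' e = x' (b e)"
        using adm that unfolding admissible_def by metis+
      then show ?thesis by (simp add: segment_param_def)
    qed
    ultimately show ?thesis
      using t unfolding admissible_def by auto
  qed
  then have "{t. \<not> admissible (?x t) (?y t)} \<subseteq> ?bad" by blast
  then show ?thesis using fin_bad by (rule finite_subset)
qed

lemma irreducible_cellule:
  fixes Q :: "('v, 'a::field, 'n::finite) picture set"
  assumes inf: "infinite (UNIV :: 'a set)" and card: "CARD('n) \<ge> 2"
  defines "Q \<equiv> cellule V E \<pi>"
  shows "irreducible_in (picture_topology V E) Q"
proof -
  have Q: "Q \<subseteq> picture_space V E" "picture_space V E \<subseteq> (ambient V E :: ('v, 'a, 'n) picture set)"
    by (auto simp: Q_def cellule_def picture_space_def)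
  \<comment> \<open>Failure of containment is reduced to one equation of \<open>C\<close> that is
    violated at one admissible parameter.\<close>
  have violated: "\<exists>f x y. multihomogeneous V E f \<and> admissible x y \<and>
      eval_mpoly (param_coords x y) f \<noteq> 0 \<and>
      (\<forall>P\<in>C. \<forall>z\<in>homogeneous_coords V E P. eval_mpoly z f = 0)"
    if C: "closedin (picture_topology V E) C" "\<not> Q \<subseteq> C" for C :: "('v, 'a, 'n) picture set"
  proof -
    obtain F where F: "\<forall>f\<in>F. multihomogeneous V E f" "C = zero_locus V E F \<inter> picture_space V E"
      using C(1) by (auto simp: picture_topology_def closedin_subtopology closedin_zariski[OF fin])
    obtain P where P: "P \<in> Q" "P \<notin> C" using C(2) by blast
    obtain x y where xy: "admissible x y" "P = param_picture x y"
      using P(1) cellule_param unfolding Q_def by metis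
    have "P \<in> ambient V E" "P \<notin> zero_locus V E F" using P Q F(2) by auto
    then obtain f z where f: "f \<in> F" "z \<in> homogeneous_coords V E P" "eval_mpoly z f \<noteq> 0"
      by (auto simp: zero_locus_def)
    \<comment> \<open>Multihomogeneity allows the arbitrary coordinates \<open>z\<close> to be
      replaced by those that are polynomial in the parameters.\<close>
    then have "eval_mpoly (param_coords x y) f \<noteq> 0"
      using multihomogeneous_vanish_iff[OF fin _ \<open>P \<in> ambient V E\<close> f(2)] F(1)
        param_coords_in_homogeneous_coords[of x y] xy(2) by blast
    moreover have "\<forall>P\<in>C. \<forall>z\<in>homogeneous_coords V E P. eval_mpoly z f = 0"
      using F(2) f(1) by (auto simp: zero_locus_def)
    ultimately show ?thesis using F(1) f(1) xy(1) by blast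
  qed
  have "Q \<subseteq> C \<or> Q \<subseteq> D"
    if CD: "closedin (picture_topology V E) C" "closedin (picture_topology V E) D" "Q \<subseteq> C \<union> D" for C D
  proof (rule ccontr)
    assume "\<not> (Q \<subseteq> C \<or> Q \<subseteq> D)"
    then obtain f x y g x' y' where
      xy: "admissible x y" "eval_mpoly (param_coords x y) f \<noteq> 0" "admissible x' y'"
        "eval_mpoly (param_coords x' y') g \<noteq> 0"
      and C: "\<forall>P\<in>C. \<forall>z\<in>homogeneous_coords V E P. eval_mpoly z f = 0"
      and D: "\<forall>P\<in>D. \<forall>z\<in>homogeneous_coords V E P. eval_mpoly z g = 0"
      using violated[OF CD(1)] violated[OF CD(2)] by blast
    let ?x = "segment_param x x'" and ?y = "segment_param y y'"
    \<comment> \<open>The polynomial \<open>f\<close> is nonzero at the end \<open>t = 0\<close>,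
      and \<open>g\<close> at the end \<open>t = 1\<close>.\<close>
    have "finite {t. eval_mpoly (param_coords (?x t) (?y t)) f = 0}"
      by (intro finite_zeros_polynomial_fun[where s = 0] polynomial_fun_eval_mpoly
        polynomial_fun_param_coords_segment) (simp add: xy)
    moreover have "finite {t. eval_mpoly (param_coords (?x t) (?y t)) g = 0}"
      by (intro finite_zeros_polynomial_fun[where s = 1] polynomial_fun_eval_mpoly
        polynomial_fun_param_coords_segment) (simp add: xy)
    moreover note finite_not_admissible_segment[OF xy(1,3)]
    ultimately have "finite ({t. eval_mpoly (param_coords (?x t) (?y t)) f = 0} \<union>
        {t. eval_mpoly (param_coords (?x t) (?y t)) g = 0} \<union> {t. \<not> admissible (?x t) (?y t)})"
      by simp
    \<comment> \<open>An infinite field has a parameter outside the three finite exceptional sets;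
      its picture lies in the cellule but in neither \<open>C\<close> nor \<open>D\<close>.\<close>
    from ex_new_if_finite[OF inf this] obtain t where
      t: "eval_mpoly (param_coords (?x t) (?y t)) f \<noteq> 0"
        "eval_mpoly (param_coords (?x t) (?y t)) g \<noteq> 0" "admissible (?x t) (?y t)"
      by auto
    have "param_picture (?x t) (?y t) \<in> C \<union> D"
      using param_picture_in_cellule[OF t(3)] CD(3) by (auto simp: Q_def)
    then show False
      using C D t(1,2) param_coords_in_homogeneous_coords by blast
  qed
  moreover have "Q \<noteq> {}" unfolding Q_def by (rule cellule_nonempty[OF inf card])
  moreover have "topspace (picture_topology V E) = (picture_space V E :: ('v, 'a, 'n) picture set)"
    using Q(2) by (auto simp: picture_topology_def topspace_zariski[OF fin])
  ultimately show ?thesis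
    using Q(1) by (auto simp: irreducible_in_def)
qed

end

section \<open>The picture space as a finite union of cellules\<close>

text \<open>Each picture lies in the cellule of the partition of \<open>V\<close> into the fibres of
  its vertex map.\<close>

lemma picture_space_eq_Union_cellules:
  "picture_space V E = (\<Union>\<pi>\<in>{\<pi>. partition_on V \<pi>}. cellule V E \<pi>)"
proof (intro equalityI subsetI)
  fix P assume P: "P \<in> picture_space V E"
  let ?\<pi> = "(\<lambda>v. {w \<in> V. fst P w = fst P v}) ` V"
  have "partition_on V ?\<pi>"
    by (rule partition_onI) (auto simp: disjnt_def)
  moreover have "P \<in> cellule V E ?\<pi>"
    using P by (auto simp: cellule_def same_block_def)
  ultimately show "P \<in> (\<Union>\<pi>\<in>{\<pi>. partition_on V \<pi>}. cellule V E \<pi>)" by blast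
qed (auto simp: cellule_def)

theorem proposition2p1:
  fixes V :: "'v set" and E :: "'v set set" and d :: nat
  assumes "finite_simple_graph V E"
    and "d \<ge> 1" and "CARD('n::finite) = d + 1"
  shows "irreducible_components (picture_topology V E :: ('v, 'a::alg_closed_field, 'n) picture topology) =
    maximal_sets {picture_topology V E closure_of cellule V E \<pi> |\<pi>. partition_on V \<pi>}"
proof -
  let ?X = "picture_topology V E :: ('v, 'a, 'n) picture topology"
  let ?\<A> = "cellule V E ` {\<pi>. partition_on V \<pi>} :: ('v, 'a, 'n) picture set set"
  have fin: "finite V" and E: "E \<subseteq> Pow V"
    using assms(1) by (auto simp: finite_simple_graph_def)
  then have finE: "finite E" by (meson finite_Pow_iff finite_subset)
  have "\<exists>v w. e = {v, w} \<and> v \<in> V \<and> w \<in> V" if "e \<in> E" for e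
  proof -
    have "e \<subseteq> V" "card e = 2" using assms(1) that by (auto simp: finite_simple_graph_def)
    then show ?thesis by (auto simp: card_2_iff)
  qed
  \<comment> \<open>An arbitrary orientation of the edges, fixed once for all partitions.\<close>
  then obtain a b where ab: "\<And>e. e \<in> E \<Longrightarrow> e = {a e, b e} \<and> a e \<in> V \<and> b e \<in> V"
    by metis
  have "irreducible_in ?X A" if A: "A \<in> ?\<A>" for A
  proof -
    obtain \<pi> where \<pi>: "partition_on V \<pi>" "A = cellule V E \<pi>" using A by blast
    interpret oriented_graph V E a b \<pi>
      by unfold_locales (use fin finE ab \<pi>(1) in blast)+
    show ?thesis
      unfolding \<pi>(2) using assms(2,3) by (intro irreducible_cellule infinite_UNIV_alg_closed) simp
  qed
  moreover have "finite ?\<A>"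
    using finitely_many_partition_on[OF fin] by simp
  moreover have "topspace ?X = \<Union>?\<A>"
  proof -
    have "picture_space V E \<subseteq> (ambient V E :: ('v, 'a, 'n) picture set)"
      by (auto simp: picture_space_def)
    then have "topspace ?X = picture_space V E"
      by (auto simp: picture_topology_def topspace_zariski[OF fin finE])
    then show ?thesis by (simp add: picture_space_eq_Union_cellules)
  qed
  moreover have "{?X closure_of cellule V E \<pi> |\<pi>. partition_on V \<pi>} = (closure_of) ?X ` ?\<A>"
    by blast
  ultimately show ?thesis
    using irreducible_components_finite_cover[of ?\<A> ?X] by simp
qed

end
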